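(* Let $M$ be a left $\mathbb{O}$-module and let $\mathscr{A}(M)=\{m\in M\mid [p,q,m]=0 \text{ for all } p,q\in\mathbb{O}\}$. Then $M$ admits a compatible $\mathbb{O}$-bimodule structure if and only if $M=\mathbb{O}\mathscr{A}(M)$. Moreover, if $M$ admits a compatible $\mathbb{O}$-bimodule structure, then this structure is unique.
   Context: $\mathbb{O}$ is the real division algebra of octonions. A left $\mathbb{O}$-module is a real vector space $M$ with an $\mathbb{R}$-bilinear map $\mathbb{O}\times M\to M$, $(p,m)\mapsto pm$, such that $1m=m$ and $[p,q,m]=-[q,p,m]$ for all $p,q\in\mathbb{O}$, $m\in M$, where $[p,q,m]:=(pq)m-p(qm)$. An $\mathbb{O}$-bimodule is a left $\mathbb{O}$-module $M$ with in addition an $\mathbb{R}$-bilinear right multiplication $M\times\mathbb{O}\to M$, $(m,p)\mapsto mp$, with $m1=m$, such that $[p,q,m]=[m,p,q]=[q,m,p]$ for all $p,q\in\mathbb{O}$, $m\in M$, where $[m,p,q]:=(mp)q-m(pq)$ and $[q,m,p]:=(qm)p-q(mp)$. A compatible bimodule structure on a left $\mathbb{O}$-module $M$ is a right multiplication on $M$ which together with the given left multiplication makes $M$ an $\mathbb{O}$-bimodule. $\mathbb{O}\mathscr{A}(M)$ denotes the set of all finite sums $\sum_i p_i x_i$ with $p_i\in\mathbb{O}$, $x_i\in\mathscr{A}(M)$. *)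

theory Defs
  imports "HOL-Analysis.Analysis"
begin

text \<open>
  The octonions are obtained by applying the Cayley-Dickson doubling
  \<open>(a, b) (c, d) = (a c - d* b, d a + b c*)\<close>, \<open>(a, b)* = (a*, - b)\<close>
  twice, starting from the complex numbers.  The real vector space structure of the
  quaternions is the one of the library's product type.
\<close>

type_synonym quat = "complex \<times> complex"

definition quat_cnj :: "quat \<Rightarrow> quat"
  where "quat_cnj x = (cnj (fst x), - snd x)"

definition quat_mult :: "quat \<Rightarrow> quat \<Rightarrow> quat"
  where "quat_mult x y =
    (fst x * fst y - cnj (snd y) * snd x, snd y * fst x + snd x * cnj (fst y))"

datatype octo = Octo (oct1: quat) (oct2: quat)

instantiation octo :: real_vector
begin

definition zero_octo where "0 = Octo 0 0"
definition plus_octo where "x + y = Octo (oct1 x + oct1 y) (oct2 x + oct2 y)"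
definition uminus_octo where "- x = Octo (- oct1 x) (- oct2 x)"
definition minus_octo where "x - y = Octo (oct1 x - oct1 y) (oct2 x - oct2 y)"
definition scaleR_octo where "r *\<^sub>R x = Octo (r *\<^sub>R oct1 x) (r *\<^sub>R oct2 x)"

instance
  by standard
    (simp_all add: zero_octo_def plus_octo_def uminus_octo_def minus_octo_def scaleR_octo_def
      algebra_simps)

end

instantiation octo :: "{one, times}"
begin

definition one_octo where "1 = Octo (1, 0) 0"
definition times_octo where
  "x * y = Octo
    (quat_mult (oct1 x) (oct1 y) - quat_mult (quat_cnj (oct2 y)) (oct2 x))
    (quat_mult (oct2 y) (oct1 x) + quat_mult (oct2 x) (quat_cnj (oct1 y)))"

instance ..

end

definition octo_normsq :: "octo \<Rightarrow> real"
  where "octo_normsq x = (norm (oct1 x))\<^sup>2 + (norm (oct2 x))\<^sup>2"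

lemmas octo_coord_defs =
  zero_octo_def plus_octo_def uminus_octo_def minus_octo_def scaleR_octo_def
  one_octo_def times_octo_def quat_mult_def quat_cnj_def

lemma octo_one_mult [simp]: "1 * x = x" and octo_mult_one [simp]: "x * 1 = x"
  for x :: octo
  by (cases x; simp add: octo_coord_defs zero_prod_def)+

lemma bilinear_octo_mult: "bilinear ((*) :: octo \<Rightarrow> octo \<Rightarrow> octo)"
  by (auto simp: bilinear_def octo_coord_defs algebra_simps prod_eq_iff intro!: linearI)

text \<open>
  The next three facts certify that this is the real division algebra of octonions: it is
  an alternative algebra with a multiplicative positive definite quadratic form, and it
  is not associative.
\<close>

lemma octo_alternative:
  fixes x y :: octo
  shows "(x * x) * y = x * (x * y)" and "(y * x) * x = y * (x * x)"
proof -
  obtain a b c d where x: "x = Octo (a, b) (c, d)" by (metis octo.exhaust prod.exhaust)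
  obtain e f g h where y: "y = Octo (e, f) (g, h)" by (metis octo.exhaust prod.exhaust)
  show "(x * x) * y = x * (x * y)"
    unfolding x y by (simp add: octo_coord_defs complex_eq_iff algebra_simps)
  show "(y * x) * x = y * (x * x)"
    unfolding x y by (simp add: octo_coord_defs complex_eq_iff algebra_simps)
qed

lemma octo_normsq_mult: "octo_normsq (x * y) = octo_normsq x * octo_normsq y"
  and octo_normsq_eq_0_iff: "octo_normsq x = 0 \<longleftrightarrow> x = 0"
proof -
  have *: "octo_normsq (Octo (a, b) (c, d)) =
      (Re a)\<^sup>2 + (Im a)\<^sup>2 + (Re b)\<^sup>2 + (Im b)\<^sup>2 + (Re c)\<^sup>2 + (Im c)\<^sup>2 + (Re d)\<^sup>2 + (Im d)\<^sup>2" for a b c d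
    by (simp add: octo_normsq_def norm_prod_def cmod_power2)
  obtain a b c d where x: "x = Octo (a, b) (c, d)" by (metis octo.exhaust prod.exhaust)
  obtain e f g h where y: "y = Octo (e, f) (g, h)" by (metis octo.exhaust prod.exhaust)
  show "octo_normsq (x * y) = octo_normsq x * octo_normsq y"
    unfolding x y by (simp add: * octo_coord_defs) algebra
  show "octo_normsq x = 0 \<longleftrightarrow> x = 0"
    by (cases x) (simp add: octo_normsq_def zero_octo_def sum_power2_eq_zero_iff)
qed

lemma octo_not_associative: "\<exists>x y z :: octo. (x * y) * z \<noteq> x * (y * z)"
  by (rule exI[of _ "Octo (\<i>, 0) 0"], rule exI[of _ "Octo (0, 1) 0"],
      rule exI[of _ "Octo 0 (1, 0)"])
    (simp add: octo_coord_defs complex_eq_iff)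

text \<open>
  A module has as underlying real vector space a whole type \<open>'m :: real_vector\<close>; the left
  action \<open>p m\<close> is \<open>l p m\<close> and the right action \<open>m p\<close> is \<open>r m p\<close>.
\<close>

locale octo_left_module =
  fixes l :: "octo \<Rightarrow> 'm::real_vector \<Rightarrow> 'm"
  assumes bilinear_left: "bilinear l"
    and one_left: "l 1 m = m"
    and left_alternating:
      "l (p * q) m - l p (l q m) = - (l (q * p) m - l q (l p m))"

locale octo_bimodule = octo_left_module l
  for l :: "octo \<Rightarrow> 'm::real_vector \<Rightarrow> 'm" +
  fixes r :: "'m \<Rightarrow> octo \<Rightarrow> 'm"
  assumes bilinear_right: "bilinear r"
    and right_one: "r m 1 = m"
    and assoc_left_right: "l (p * q) m - l p (l q m) = r (r m p) q - r m (p * q)"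
    and assoc_right_middle: "r (r m p) q - r m (p * q) = r (l q m) p - l q (r m p)"

definition assoc_nucleus :: "(octo \<Rightarrow> 'm::real_vector \<Rightarrow> 'm) \<Rightarrow> 'm set"
  where "assoc_nucleus l = {m. \<forall>p q. l (p * q) m - l p (l q m) = 0}"

definition octo_sums :: "(octo \<Rightarrow> 'm::real_vector \<Rightarrow> 'm) \<Rightarrow> 'm set \<Rightarrow> 'm set"
  where "octo_sums l X =
    {\<Sum>i<n. l (p i) (x i) | (n::nat) (p::nat \<Rightarrow> octo) x. \<forall>i<n. x i \<in> X}"

end

theory Submission
  imports Defs
begin

text \<open>
  The left multiplications by the imaginary units generate a Clifford algebra, whose volume
  element is central.  In a bimodule \<open>n = p m + m p\<close> satisfies \<open>[p, q, n] = 0\<close> for anticommuting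
  imaginary units \<open>p\<close>, \<open>q\<close>, which fixes the sign of the volume element on such \<open>n\<close>; the identity
  \<open>[p, q, m] = (q m) p - q (m p)\<close> then propagates this sign to the whole module.  With the sign
  known, the common eigenvectors of three commuting involutions are nuclear, and they span the
  module over the octonions.  Conversely, right multiplication of octonions is a combination of
  products of left multiplications, so it makes sense on any left module, and on \<open>p x\<close> with \<open>x\<close>
  nuclear it is \<open>(p x) q = (p q) x\<close>; the bimodule laws thereby reduce to identities between
  octonions.  Uniqueness holds because nuclear elements of a bimodule commute with all octonions:
  both \<open>[p, q, w] x\<close> and \<open>x [p, q, w]\<close> equal \<open>[p, q, w x]\<close>, and the imaginary octonions are
  spanned by associators.
\<close>

section \<open>Imaginary units and the associator of the octonions\<close>

definition e1 :: octo where "e1 = Octo (\<i>, 0) 0"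
definition e2 :: octo where "e2 = Octo (0, 1) 0"
definition e3 :: octo where "e3 = Octo (0, \<i>) 0"
definition e4 :: octo where "e4 = Octo 0 (1, 0)"
definition e5 :: octo where "e5 = Octo 0 (\<i>, 0)"
definition e6 :: octo where "e6 = Octo 0 (0, 1)"
definition e7 :: octo where "e7 = Octo 0 (0, \<i>)"

lemmas unit_defs = e1_def e2_def e3_def e4_def e5_def e6_def e7_def

lemma unit_mult:
  "e1 * e1 = - 1" "e1 * e2 = e3" "e1 * e3 = - e2" "e1 * e4 = e5" "e1 * e5 = - e4" "e1 * e6 = - e7" "e1 * e7 = e6"
  "e2 * e1 = - e3" "e2 * e2 = - 1" "e2 * e3 = e1" "e2 * e4 = e6" "e2 * e5 = e7" "e2 * e6 = - e4" "e2 * e7 = - e5"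
  "e3 * e1 = e2" "e3 * e2 = - e1" "e3 * e3 = - 1" "e3 * e4 = e7" "e3 * e5 = - e6" "e3 * e6 = e5" "e3 * e7 = - e4"
  "e4 * e1 = - e5" "e4 * e2 = - e6" "e4 * e3 = - e7" "e4 * e4 = - 1" "e4 * e5 = e1" "e4 * e6 = e2" "e4 * e7 = e3"
  "e5 * e1 = e4" "e5 * e2 = - e7" "e5 * e3 = e6" "e5 * e4 = - e1" "e5 * e5 = - 1" "e5 * e6 = - e3" "e5 * e7 = e2"
  "e6 * e1 = e7" "e6 * e2 = e4" "e6 * e3 = - e5" "e6 * e4 = - e2" "e6 * e5 = e3" "e6 * e6 = - 1" "e6 * e7 = - e1"
  "e7 * e1 = - e6" "e7 * e2 = e5" "e7 * e3 = e4" "e7 * e4 = - e3" "e7 * e5 = - e2" "e7 * e6 = e1" "e7 * e7 = - 1"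
  by (simp_all add: unit_defs octo_coord_defs zero_prod_def)

lemma octo_mult_linear:
  fixes p q s :: octo
  shows "(p + q) * s = p * s + q * s" "s * (p + q) = s * p + s * q"
    "(c *\<^sub>R p) * s = c *\<^sub>R (p * s)" "s * (c *\<^sub>R p) = c *\<^sub>R (s * p)"
    "(- p) * s = - (p * s)" "s * (- p) = - (s * p)"
    "(p - q) * s = p * s - q * s" "s * (p - q) = s * p - s * q"
  using bilinear_octo_mult
  by (simp_all add: bilinear_ladd bilinear_radd bilinear_lmul bilinear_rmul bilinear_lneg
      bilinear_rneg bilinear_lsub bilinear_rsub)

text \<open>The eight units span the octonions over the reals.\<close>

lemma octo_induct [case_names add scale one e1 e2 e3 e4 e5 e6 e7]:
  assumes add: "\<And>p q. P p \<Longrightarrow> P q \<Longrightarrow> P (p + q)"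
    and scale: "\<And>c p. P p \<Longrightarrow> P (c *\<^sub>R p)"
    and base: "P 1" "P e1" "P e2" "P e3" "P e4" "P e5" "P e6" "P e7"
  shows "P q"
proof -
  obtain a b c d where q: "q = Octo (a, b) (c, d)"
    by (metis octo.exhaust prod.exhaust)
  have "q = Re a *\<^sub>R 1 + Im a *\<^sub>R e1 + Re b *\<^sub>R e2 + Im b *\<^sub>R e3
      + Re c *\<^sub>R e4 + Im c *\<^sub>R e5 + Re d *\<^sub>R e6 + Im d *\<^sub>R e7"
    by (simp add: q unit_defs octo_coord_defs zero_prod_def complex_eq_iff)
  moreover have "P \<dots>"
    by (intro add scale base)
  ultimately show ?thesis by simp
qed

text \<open>Polarizing the two alternative laws makes the associator change sign when its first two
  or its last two arguments are swapped; a cyclic shift is a product of two such swaps.\<close>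

lemma octo_assoc_cyclic:
  fixes p q s :: octo
  shows "(p * q) * s - p * (q * s) = (s * p) * q - s * (p * q)"
proof -
  have "(p * q) * s - p * (q * s) = - ((q * p) * s - q * (p * s))" for p q s :: octo
    using octo_alternative(1)[of "p + q" s] octo_alternative(1)[of p s] octo_alternative(1)[of q s]
    by (simp add: octo_mult_linear algebra_simps)
  moreover have "(s * p) * q - s * (p * q) = - ((s * q) * p - s * (q * p))" for p q s :: octo
    using octo_alternative(2)[of s "p + q"] octo_alternative(2)[of s p] octo_alternative(2)[of s q]
    by (simp add: octo_mult_linear algebra_simps)
  ultimately show ?thesis
    by (metis minus_minus)
qed

section \<open>Eigenvectors of involutions and closure of octonion sums\<close>

lemma eq_neg_self: "x = - x \<Longrightarrow> x = 0" for x :: "'a::real_vector"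
  using scaleR_2[of x] by (simp add: eq_neg_iff_add_eq_0)

text \<open>\<open>u\<close> is the -1 part of \<open>m\<close> under \<open>T\<close>. The +1 part
  is \<open>L v\<close>, because \<open>L\<close> anticommutes with \<open>T\<close> and so
  interchanges the two eigenspaces. Maps in \<open>F\<close> commute with \<open>T\<close> and
  \<open>L\<close>, so their eigenvalue -1 survives.\<close>

lemma involution_split:
  fixes T L :: "'m::real_vector \<Rightarrow> 'm"
  assumes T: "linear T" "\<And>m. T (T m) = m"
    and L: "linear L" "\<And>m. L (L m) = - m"
    and TL: "\<And>m. T (L m) = - L (T m)"
    and S: "\<And>S. S \<in> F \<Longrightarrow> linear S" "\<And>S x. S \<in> F \<Longrightarrow> S (T x) = T (S x)"
      "\<And>S x. S \<in> F \<Longrightarrow> S (L x) = L (S x)" "\<And>S. S \<in> F \<Longrightarrow> S m = - m"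
  obtains u v where "m = u + L v" "\<And>S. S \<in> insert T F \<Longrightarrow> S u = - u \<and> S v = - v"
proof
  define u where "u = (1 / 2) *\<^sub>R (m - T m)"
  define v where "v = - (1 / 2) *\<^sub>R L (m + T m)"
  note lin = linear_add linear_diff linear_scale linear_neg
  show "m = u + L v"
    by (simp add: u_def v_def lin[OF L(1)] L(2) algebra_simps flip: scaleR_add_left)
  have "T u = - u" "T v = - v"
    by (simp_all add: u_def v_def lin[OF T(1)] lin[OF L(1)] T(2) TL algebra_simps)
  moreover have "S u = - u \<and> S v = - v" if "S \<in> F" for S
    by (simp add: u_def v_def lin[OF S(1)[OF that]] lin[OF L(1)] lin[OF T(1)] S(2-4)[OF that]
        algebra_simps)
  ultimately show "S u = - u \<and> S v = - v" if "S \<in> insert T F" for S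
    using that by auto
qed

lemma octo_sums_base: "x \<in> X \<Longrightarrow> l p x \<in> octo_sums l X"
  unfolding octo_sums_def
  by (intro CollectI exI[of _ "Suc 0"] exI[of _ "\<lambda>_. p"] exI[of _ "\<lambda>_. x"]) simp

lemma octo_sums_add:
  assumes "a \<in> octo_sums l X" "b \<in> octo_sums l X"
  shows "a + b \<in> octo_sums l X"
proof -
  obtain n :: nat and p x where a: "a = (\<Sum>i<n. l (p i) (x i))" "\<forall>i<n. x i \<in> X"
    using assms(1) unfolding octo_sums_def by blast
  obtain k :: nat and q y where b: "b = (\<Sum>i<k. l (q i) (y i))" "\<forall>i<k. y i \<in> X"
    using assms(2) unfolding octo_sums_def by blast
  define p' where "p' i = (if i < n then p i else q (i - n))" for i
  define x' where "x' i = (if i < n then x i else y (i - n))" for i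
  have "(\<Sum>i<n + j. l (p' i) (x' i)) = a + (\<Sum>i<j. l (q i) (y i))" for j
    by (induction j) (simp_all add: a p'_def x'_def)
  then have "(\<Sum>i<n + k. l (p' i) (x' i)) = a + b"
    by (simp add: b)
  moreover have "\<forall>i<n + k. x' i \<in> X"
    using a b by (auto simp: x'_def)
  ultimately show ?thesis
    unfolding octo_sums_def
    by (intro CollectI exI[of _ "n + k"] exI[of _ p'] exI[of _ x']) simp
qed

lemma octo_sums_induct [consumes 1, case_names zero add base]:
  assumes "m \<in> octo_sums l X"
    and zero: "P 0"
    and add: "\<And>a b. P a \<Longrightarrow> P b \<Longrightarrow> P (a + b)"
    and base: "\<And>p x. x \<in> X \<Longrightarrow> P (l p x)"
  shows "P m"
proof -
  obtain n :: nat and p x where m: "m = (\<Sum>i<n. l (p i) (x i))" and x: "\<forall>i<n. x i \<in> X"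
    using assms(1) unfolding octo_sums_def by (auto simp only: mem_Collect_eq)
  have "P (\<Sum>i<k. l (p i) (x i))" if "k \<le> n" for k
    using that
  proof (induction k)
    case 0
    show ?case using zero by simp
  next
    case (Suc k)
    then have "P (\<Sum>i<k. l (p i) (x i))" and "P (l (p k) (x k))"
      using x by (auto intro: base)
    then show ?case unfolding sum.lessThan_Suc by (rule add)
  qed
  then show ?thesis by (simp add: m)
qed

section \<open>Clifford relations and nuclear vectors in a left module\<close>

context octo_left_module
begin

lemma left_linear:
  "l (p + q) m = l p m + l q m" "l p (m + m') = l p m + l p m'"
  "l (c *\<^sub>R p) m = c *\<^sub>R l p m" "l p (c *\<^sub>R m) = c *\<^sub>R l p m"
  "l (- p) m = - l p m" "l p (- m) = - l p m"
  "l (p - q) m = l p m - l q m" "l p (m - m') = l p m - l p m'"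
  "l p 0 = 0"
  using bilinear_left
  by (simp_all add: bilinear_ladd bilinear_radd bilinear_lmul bilinear_rmul bilinear_lneg
      bilinear_rneg bilinear_lsub bilinear_rsub bilinear_rzero)

lemma linear_left: "linear (l p)"
  using bilinear_left by (simp add: bilinear_def)

lemma left_unit_square: "p * p = - 1 \<Longrightarrow> l p (l p m) = - m"
  using eq_neg_self[OF left_alternating[of p p m]] by (simp add: left_linear one_left)

lemma left_anticommute: "q * p = - (p * q) \<Longrightarrow> l q (l p m) = - l p (l q m)"
  using left_alternating[of p q m] by (simp add: left_linear add_eq_0_iff)

text \<open>Normal ordering of words in the units; \<open>e4\<close> precedes \<open>e3\<close> so that the words in the
  generators \<open>e1\<close>, \<open>e2\<close>, \<open>e4\<close> are moved to the left.\<close>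

lemma left_order:
  "l e1 (l e1 m) = - m" "l e2 (l e2 m) = - m" "l e3 (l e3 m) = - m" "l e4 (l e4 m) = - m"
  "l e5 (l e5 m) = - m" "l e6 (l e6 m) = - m" "l e7 (l e7 m) = - m"
  "l e2 (l e1 m) = - l e1 (l e2 m)" "l e3 (l e1 m) = - l e1 (l e3 m)"
  "l e4 (l e1 m) = - l e1 (l e4 m)" "l e5 (l e1 m) = - l e1 (l e5 m)"
  "l e6 (l e1 m) = - l e1 (l e6 m)" "l e7 (l e1 m) = - l e1 (l e7 m)"
  "l e3 (l e2 m) = - l e2 (l e3 m)" "l e4 (l e2 m) = - l e2 (l e4 m)"
  "l e5 (l e2 m) = - l e2 (l e5 m)" "l e6 (l e2 m) = - l e2 (l e6 m)"
  "l e7 (l e2 m) = - l e2 (l e7 m)" "l e3 (l e4 m) = - l e4 (l e3 m)"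
  "l e5 (l e4 m) = - l e4 (l e5 m)" "l e6 (l e4 m) = - l e4 (l e6 m)"
  "l e7 (l e4 m) = - l e4 (l e7 m)" "l e5 (l e3 m) = - l e3 (l e5 m)"
  "l e6 (l e3 m) = - l e3 (l e6 m)" "l e7 (l e3 m) = - l e3 (l e7 m)"
  "l e6 (l e5 m) = - l e5 (l e6 m)" "l e7 (l e5 m) = - l e5 (l e7 m)"
  "l e7 (l e6 m) = - l e6 (l e7 m)"
  by (rule left_unit_square left_anticommute; simp add: unit_mult)+

lemma mem_assoc_nucleus_iff: "x \<in> assoc_nucleus l \<longleftrightarrow> (\<forall>p q. l p (l q x) = l (p * q) x)"
  unfolding assoc_nucleus_def mem_Collect_eq right_minus_eq by metis

lemma octo_sums_left:
  assumes "m \<in> octo_sums l (assoc_nucleus l)"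
  shows "l q m \<in> octo_sums l (assoc_nucleus l)"
  using assms
proof (induction rule: octo_sums_induct)
  case zero
  show ?case
    unfolding octo_sums_def
    by (intro CollectI exI[of _ 0]) (simp add: left_linear)
next
  case (add a b)
  then show ?case by (simp add: left_linear octo_sums_add)
next
  case (base p x)
  then show ?case by (simp add: mem_assoc_nucleus_iff octo_sums_base)
qed

text \<open>The volume element of the Clifford algebra generated by the left multiplications: it is
  central and takes opposite values on the two irreducible left modules, the octonions and their
  conjugate.\<close>

definition clifford_volume :: "'m \<Rightarrow> 'm"
  where "clifford_volume m = l e1 (l e5 (l e2 (l e6 (l e3 (l e7 (l e4 m))))))"

text \<open>The hypotheses are relations satisfied by 1 in the octonions. They turn
  \<open>e3\<close>, \<open>e5\<close>, \<open>e6\<close>, \<open>e7\<close> acting on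
  \<open>x\<close> into words in \<open>e1\<close>, \<open>e2\<close>, \<open>e4\<close>; normal
  ordering then settles all products of two units.\<close>

lemma assoc_nucleusI:
  assumes T: "l e1 (l e2 (l e3 x)) = - x" "l e1 (l e4 (l e5 x)) = - x" "l e2 (l e4 (l e6 x)) = - x"
    and W: "clifford_volume x = - x"
  shows "x \<in> assoc_nucleus l"
proof -
  have inv: "l q x = l p (l p' x)"
    if "l p (l p' (l q x)) = - x" "p * p = - 1" "p' * p' = - 1" "p' * p = - (p * p')" for p p' q
  proof -
    have "l p' (l p (l p (l p' (l q x)))) = l q x"
      by (simp add: left_unit_square that(2,3) left_linear)
    then show ?thesis
      using that(1) left_anticommute[OF that(4)] by (simp add: left_linear)
  qed
  have e3: "l e3 x = l e1 (l e2 x)" and e5: "l e5 x = l e1 (l e4 x)" and e6: "l e6 x = l e2 (l e4 x)"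
    by (rule inv[OF T(1)] inv[OF T(2)] inv[OF T(3)]; simp add: unit_mult)+
  \<comment> \<open>Moving \<open>e7\<close> to the front passes five units, whence the
    sign.\<close>
  have "clifford_volume x = - l e7 (l e1 (l e5 (l e2 (l e6 (l e3 (l e4 x))))))"
    by (simp add: clifford_volume_def left_order left_linear)
  also have "\<dots> = l e1 (l e2 (l e4 (l e7 x)))"
    by (simp add: left_order left_linear e3 e5 e6)
  finally have "clifford_volume x = l e1 (l e2 (l e4 (l e7 x)))" .
  then have e7: "l e7 x = - l e1 (l e2 (l e4 x))"
    using arg_cong[OF W, of "\<lambda>y. l e4 (l e2 (l e1 y))"]
    by (simp add: left_order left_linear minus_equation_iff[of "l e7 x"])
  note red = e3 e5 e6 e7
  have "l p (l q x) = l (p * q) x" for p q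
  proof (induction p rule: octo_induct)
    case e1
    show ?case
      by (induction q rule: octo_induct)
        (simp_all add: octo_mult_linear left_linear unit_mult left_order red one_left)
  next
    case e2
    show ?case
      by (induction q rule: octo_induct)
        (simp_all add: octo_mult_linear left_linear unit_mult left_order red one_left)
  next
    case e3
    show ?case
      by (induction q rule: octo_induct)
        (simp_all add: octo_mult_linear left_linear unit_mult left_order red one_left)
  next
    case e4
    show ?case
      by (induction q rule: octo_induct)
        (simp_all add: octo_mult_linear left_linear unit_mult left_order red one_left)
  next
    case e5
    show ?case
      by (induction q rule: octo_induct)
        (simp_all add: octo_mult_linear left_linear unit_mult left_order red one_left)
  next
    case e6
    show ?case
      by (induction q rule: octo_induct)
        (simp_all add: octo_mult_linear left_linear unit_mult left_order red one_left)
  next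
    case e7
    show ?case
      by (induction q rule: octo_induct)
        (simp_all add: octo_mult_linear left_linear unit_mult left_order red one_left)
  next
    case (add p p')
    then show ?case by (simp add: octo_mult_linear left_linear)
  next
    case (scale c p)
    then show ?case by (simp add: octo_mult_linear left_linear)
  next
    case one
    show ?case by (simp add: one_left)
  qed
  then show ?thesis unfolding mem_assoc_nucleus_iff by blast
qed

text \<open>Splitting along the three involutions \<open>L\<^sub>p L\<^sub>q L\<^sub>p\<^sub>q\<close> reduces to vectors fixed up to sign by
  all of them, and these are nuclear once the volume element acts as on the octonions.\<close>

lemma octo_sums_eq_UNIV:
  assumes W: "\<And>m. clifford_volume m = - m"
  shows "octo_sums l (assoc_nucleus l) = UNIV"
proof -
  define T1 where "T1 m = l e1 (l e2 (l e3 m))" for m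
  define T2 where "T2 m = l e1 (l e4 (l e5 m))" for m
  define T3 where "T3 m = l e2 (l e4 (l e6 m))" for m
  let ?K = "octo_sums l (assoc_nucleus l)"
  note T_defs = T1_def T2_def T3_def
  have lin: "linear T1" "linear T2" "linear T3"
    by (auto simp: T_defs left_linear intro!: linearI)
  have sq: "T1 (T1 m) = m" "T2 (T2 m) = m" "T3 (T3 m) = m" for m
    by (simp_all add: T_defs left_order left_linear)
  have unit_sq: "l e1 (l e1 m) = - m" "l e2 (l e2 m) = - m" "l e4 (l e4 m) = - m" for m
    by (simp_all add: left_order)
  \<comment> \<open>Each involution anticommutes with a unit that commutes with the involutions
    split off before it: \<open>e4\<close> for \<open>T1\<close>, \<open>e2\<close> for
    \<open>T2\<close>, \<open>e1\<close> for \<open>T3\<close>.\<close>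
  have anti: "T1 (l e4 m) = - l e4 (T1 m)" "T2 (l e2 m) = - l e2 (T2 m)" "T3 (l e1 m) = - l e1 (T3 m)" for m
    by (simp_all add: T_defs left_order left_linear)
  have comm: "T1 (T2 m) = T2 (T1 m)" "T1 (T3 m) = T3 (T1 m)" "T2 (T3 m) = T3 (T2 m)"
    "T1 (l e2 m) = l e2 (T1 m)" "T1 (l e1 m) = l e1 (T1 m)" "T2 (l e1 m) = l e1 (T2 m)" for m
    by (simp_all add: T_defs left_order left_linear)
  have K: "u + l q v \<in> ?K" if "u \<in> ?K" "v \<in> ?K" for u v q
    using that by (simp add: octo_sums_add octo_sums_left)
  have K3: "x \<in> ?K" if "T1 x = - x" "T2 x = - x" "T3 x = - x" for x
  proof -
    have "x \<in> assoc_nucleus l"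
      using that W by (simp add: assoc_nucleusI T_defs)
    then show ?thesis
      using octo_sums_base[of x _ l 1] by (simp add: one_left)
  qed
  have K2: "x \<in> ?K" if x: "T1 x = - x" "T2 x = - x" for x
  proof -
    obtain u v where "x = u + l e1 v" "\<And>S. S \<in> {T3, T1, T2} \<Longrightarrow> S u = - u \<and> S v = - v"
      by (rule involution_split[of T3 "l e1" "{T1, T2}" x,
            OF lin(3) sq(3) linear_left unit_sq(1) anti(3)])
        (auto simp: lin comm x)
    then show ?thesis by (simp add: K K3)
  qed
  have K1: "x \<in> ?K" if x: "T1 x = - x" for x
  proof -
    obtain u v where "x = u + l e2 v" "\<And>S. S \<in> {T2, T1} \<Longrightarrow> S u = - u \<and> S v = - v"
      by (rule involution_split[of T2 "l e2" "{T1}" x,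
            OF lin(2) sq(2) linear_left unit_sq(2) anti(2)])
        (auto simp: lin comm x)
    then show ?thesis by (simp add: K K2)
  qed
  have "x \<in> ?K" for x
  proof -
    obtain u v where "x = u + l e4 v" "\<And>S. S \<in> {T1} \<Longrightarrow> S u = - u \<and> S v = - v"
      by (rule involution_split[of T1 "l e4" "{}" x,
            OF lin(1) sq(1) linear_left unit_sq(3) anti(1)])
        (auto simp: lin comm)
    then show ?thesis by (simp add: K K1)
  qed
  then show ?thesis by auto
qed

section \<open>Right multiplication built from left multiplications\<close>

text \<open>In terms of associators this is \<open>q m - (1/4) \<Sum>\<^sub>j [e\<^sub>j, e\<^sub>j* q, m]\<close>, the sum over an orthonormal
  basis: left multiplications alone recover the right multiplication of the octonions.\<close>

definition right_mult :: "'m \<Rightarrow> octo \<Rightarrow> 'm"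
  where "right_mult m q = - (1 / 4) *\<^sub>R (3 *\<^sub>R l q m + l e1 (l (e1 * q) m) + l e2 (l (e2 * q) m)
    + l e3 (l (e3 * q) m) + l e4 (l (e4 * q) m) + l e5 (l (e5 * q) m) + l e6 (l (e6 * q) m)
    + l e7 (l (e7 * q) m))"

lemma bilinear_right_mult: "bilinear right_mult"
  unfolding bilinear_def
  by (auto simp: right_mult_def octo_mult_linear left_linear algebra_simps intro!: linearI)

end

text \<open>This is the formula of \<open>right_mult\<close> on the octonions as a left module. Four
  times the defect is the bilinear map \<open>B\<close>, so pairs of units suffice.\<close>

lemma octo_mult_eq_left_mults:
  fixes p q :: octo
  shows "p * q = - (1 / 4) *\<^sub>R (3 *\<^sub>R (q * p) + e1 * ((e1 * q) * p) + e2 * ((e2 * q) * p)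
    + e3 * ((e3 * q) * p) + e4 * ((e4 * q) * p) + e5 * ((e5 * q) * p) + e6 * ((e6 * q) * p)
    + e7 * ((e7 * q) * p))"
proof -
  define B where "B p q = 4 *\<^sub>R (p * q) + (3 *\<^sub>R (q * p) + e1 * ((e1 * q) * p)
    + e2 * ((e2 * q) * p) + e3 * ((e3 * q) * p) + e4 * ((e4 * q) * p) + e5 * ((e5 * q) * p)
    + e6 * ((e6 * q) * p) + e7 * ((e7 * q) * p))" for p q :: octo
  have lin: "B (p + p') q = B p q + B p' q" "B p (q + q') = B p q + B p q'"
    "B (c *\<^sub>R p) q = c *\<^sub>R B p q" "B p (c *\<^sub>R q) = c *\<^sub>R B p q" for p p' q q' c
    by (simp_all add: B_def octo_mult_linear scaleR_add_right mult.commute)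
  have num: "3 *\<^sub>R x = x + x + x" "4 *\<^sub>R x = x + x + x + x" for x :: octo
    using scaleR_add_left[of 2 1 x] scaleR_add_left[of 2 2 x] by (simp_all add: scaleR_2 add.assoc)
  have "B p q = 0"
  proof (induction q rule: octo_induct)
    case one
    show ?case
      by (induction p rule: octo_induct)
        (simp_all only: lin add_0 scaleR_zero_right,
          simp_all add: B_def octo_mult_linear unit_mult num)
  next
    case e1
    show ?case
      by (induction p rule: octo_induct)
        (simp_all only: lin add_0 scaleR_zero_right,
          simp_all add: B_def octo_mult_linear unit_mult num)
  next
    case e2
    show ?case
      by (induction p rule: octo_induct)
        (simp_all only: lin add_0 scaleR_zero_right,
          simp_all add: B_def octo_mult_linear unit_mult num)
  next
    case e3
    show ?case
      by (induction p rule: octo_induct)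
        (simp_all only: lin add_0 scaleR_zero_right,
          simp_all add: B_def octo_mult_linear unit_mult num)
  next
    case e4
    show ?case
      by (induction p rule: octo_induct)
        (simp_all only: lin add_0 scaleR_zero_right,
          simp_all add: B_def octo_mult_linear unit_mult num)
  next
    case e5
    show ?case
      by (induction p rule: octo_induct)
        (simp_all only: lin add_0 scaleR_zero_right,
          simp_all add: B_def octo_mult_linear unit_mult num)
  next
    case e6
    show ?case
      by (induction p rule: octo_induct)
        (simp_all only: lin add_0 scaleR_zero_right,
          simp_all add: B_def octo_mult_linear unit_mult num)
  next
    case e7
    show ?case
      by (induction p rule: octo_induct)
        (simp_all only: lin add_0 scaleR_zero_right,
          simp_all add: B_def octo_mult_linear unit_mult num)
  qed (simp_all add: lin)
  moreover have "x = - (1 / 4) *\<^sub>R y" if "4 *\<^sub>R x + y = 0" for x y :: octo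
    using that by (simp add: add_eq_0_iff)
  ultimately show ?thesis
    unfolding B_def by blast
qed

context octo_left_module
begin

text \<open>For nuclear \<open>x\<close> the map from \<open>p\<close> to \<open>l p x\<close>
  respects left multiplication, so the octonion identity carries over.\<close>

lemma right_mult_nucleus:
  assumes "x \<in> assoc_nucleus l"
  shows "right_mult (l p x) q = l (p * q) x"
proof -
  have "l s (l t x) = l (s * t) x" for s t
    using assms by (simp add: mem_assoc_nucleus_iff)
  then show ?thesis
    by (subst octo_mult_eq_left_mults) (simp add: right_mult_def left_linear)
qed

text \<open>The laws are additive in \<open>m\<close>, so \<open>m = l s x\<close> with nuclear
  \<open>x\<close> suffices; there the associator laws become the cyclic symmetry of octonion
  associators.\<close>

lemma octo_bimodule_right_mult:
  assumes "octo_sums l (assoc_nucleus l) = UNIV"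
  shows "octo_bimodule l right_mult"
proof -
  note [simp] = bilinear_ladd[OF bilinear_right_mult] bilinear_lzero[OF bilinear_right_mult]
  have nuc: "l s (l t x) = l (s * t) x" if "x \<in> assoc_nucleus l" for s t x
    using that by (simp add: mem_assoc_nucleus_iff)
  note simps = nuc right_mult_nucleus
  have K: "m \<in> octo_sums l (assoc_nucleus l)" for m
    using assms by simp
  have "right_mult m 1 = m" for m
    using K[of m] by (induction rule: octo_sums_induct) (simp_all add: simps)
  moreover have "l (p * q) m - l p (l q m) = right_mult (right_mult m p) q - right_mult m (p * q)"
    for m p q
  proof (use K[of m] in \<open>induction rule: octo_sums_induct\<close>)
    case (add a b)
    then show ?case by (simp add: left_linear add_diff_add)
  next
    case (base s x)
    then show ?case
      using arg_cong[OF octo_assoc_cyclic[of p q s], of "\<lambda>t. l t x"]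
      by (simp add: simps left_linear)
  qed (simp add: left_linear)
  moreover have "right_mult (right_mult m p) q - right_mult m (p * q)
      = right_mult (l q m) p - l q (right_mult m p)" for m p q
  proof (use K[of m] in \<open>induction rule: octo_sums_induct\<close>)
    case (add a b)
    then show ?case by (simp add: left_linear add_diff_add)
  next
    case (base s x)
    then show ?case
      using arg_cong[OF octo_assoc_cyclic[of p q s], of "\<lambda>t. l t x"]
        arg_cong[OF octo_assoc_cyclic[of q s p], of "\<lambda>t. l t x"]
      by (simp add: simps left_linear)
  qed (simp add: left_linear)
  ultimately show ?thesis
    by unfold_locales (auto simp: bilinear_right_mult)
qed

end

section \<open>Volume element and nucleus of a bimodule\<close>

context octo_bimodule
begin

lemma right_linear:
  "r m (p + q) = r m p + r m q" "r (m + m') p = r m p + r m' p"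
  "r m (c *\<^sub>R p) = c *\<^sub>R r m p" "r (c *\<^sub>R m) p = c *\<^sub>R r m p"
  "r m (- p) = - r m p" "r (- m) p = - r m p"
  "r m (p - q) = r m p - r m q" "r (m - m') p = r m p - r m' p"
  "r 0 p = 0"
  using bilinear_right
  by (simp_all add: bilinear_ladd bilinear_radd bilinear_lmul bilinear_rmul bilinear_lneg
      bilinear_rneg bilinear_lsub bilinear_rsub bilinear_lzero)

lemma right_left: "r (l q m) p = l q (r m p) + l (p * q) m - l p (l q m)"
  using assoc_left_right[of p q m] assoc_right_middle[of m p q] by (simp add: algebra_simps)

text \<open>A special case of \<open>[p, q, p m + m p] = [p\<^sup>2, q, m]\<close>.\<close>

lemma anticommutator_assoc:
  assumes "p * p = - 1" "q * p = - (p * q)"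
  shows "l (p * q) (l p m + r m p) = l p (l q (l p m + r m p))"
proof -
  have pk: "p * (p * q) = - q"
    using octo_alternative(1)[of p q] assms by (simp add: octo_mult_linear)
  have kp: "(p * q) * p = q"
    using octo_alternative(2)[of q p] assms by (simp add: octo_mult_linear)
  have "l (p * q) (r m p) - l p (l q (r m p)) = r (r (r m p) p) q - r (r m p) (p * q)"
    by (rule assoc_left_right)
  \<comment> \<open>This is [m, p, p] = [p, p, m] = 0.\<close>
  also have "r (r m p) p = - m"
    unfolding eq_neg_iff_add_eq_0
    using assoc_left_right[of p p m] assms
    by (simp add: left_linear right_linear left_unit_square one_left right_one)
  also have "r (r m p) (p * q) = r m (p * (p * q)) + l (p * (p * q)) m - l p (l (p * q) m)"
    using assoc_left_right[of p "p * q" m] by (simp add: algebra_simps)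
  finally have "l (p * q) (r m p) - l p (l q (r m p)) = l p (l (p * q) m) + l q m"
    by (simp add: pk left_linear right_linear)
  moreover have "l (p * q) (l p m) = - l p (l (p * q) m)"
    by (rule left_anticommute) (simp add: kp pk)
  moreover have "l p (l q (l p m)) = l q m"
    using assms by (simp add: left_anticommute[OF assms(2)] left_unit_square left_linear)
  ultimately show ?thesis
    by (simp add: left_linear algebra_simps)
qed

text \<open>On the image of \<open>D\<close>, \<open>e5\<close> acts as minus the product of
  \<open>e1\<close> and \<open>e4\<close>. But \<open>e2\<close> preserves this image, anticommutes
  with \<open>e5\<close> and commutes with that product, so the image is zero.\<close>

lemma clifford_volume_eq: "clifford_volume m = - m"
proof -
  define D where "D m = clifford_volume m + m" for m
  have D_left: "D (l e1 m) = l e1 (D m)" "D (l e2 m) = l e2 (D m)" "D (l e4 m) = l e4 (D m)"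
    "D (l e5 m) = l e5 (D m)" for m
    by (simp_all add: D_def clifford_volume_def left_order left_linear)
  have D_lin: "D (a + b) = D a + D b" "D (a - b) = D a - D b" for a b
    by (simp_all add: D_def clifford_volume_def left_linear)
  have D_anti: "D (l e4 m + r m e4) = 0" for m
  proof -
    define n where "n = l e4 m + r m e4"
    \<comment> \<open>Hence each pair \<open>e1 e5\<close>, \<open>e2 e6\<close>,
      \<open>e3 e7\<close> in the volume element acts as \<open>- e4\<close> on \<open>n\<close> and
      \<open>l e4 n\<close>, leaving minus the fourth power of \<open>e4\<close>, that is
      -1.\<close>
    have "l e5 n = l e1 (l e4 n)" "l e6 n = l e2 (l e4 n)" "l e7 n = l e3 (l e4 n)"
      using anticommutator_assoc[of e4 e1 m] anticommutator_assoc[of e4 e2 m]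
        anticommutator_assoc[of e4 e3 m]
      by (simp_all add: unit_mult left_linear left_order minus_equation_iff[of "l e7 n"] flip: n_def)
    then have "D n = 0"
      by (simp add: D_def clifford_volume_def left_order left_linear)
    then show ?thesis by (simp add: n_def)
  qed
  then have D_right: "D (r m e4) = - l e4 (D m)" for m
    by (simp add: D_lin D_left eq_neg_iff_add_eq_0 add.commute)
  have eq: "l e5 (D m) = - l e1 (l e4 (D m))" for m
  proof -
    have "D (r (l e1 m) e4) = D (l e1 (r m e4) + l (e4 * e1) m - l e4 (l e1 m))"
      by (simp add: right_left)
    then show ?thesis
      by (simp add: D_lin D_left D_right unit_mult left_linear left_order eq_neg_iff_add_eq_0
          add.commute)
  qed
  have "l e2 (l e5 (D m)) = - l e5 (l e2 (D m))"
    by (simp add: left_order)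
  also have "\<dots> = l e1 (l e4 (l e2 (D m)))"
    using eq[of "l e2 m"] by (simp add: D_left)
  also have "\<dots> = - l e2 (l e5 (D m))"
    by (simp add: eq left_order left_linear)
  finally have "l e2 (l e5 (D m)) = - l e2 (l e5 (D m))" .
  then have "l e2 (l e5 (D m)) = 0" by (rule eq_neg_self)
  then have "l e5 (l e2 (l e2 (l e5 (D m)))) = 0" by (simp add: left_linear)
  then have "D m = 0" by (simp add: left_order left_linear)
  then show ?thesis by (simp add: D_def eq_neg_iff_add_eq_0)
qed

lemma nucleus_commute:
  assumes x: "x \<in> assoc_nucleus l"
  shows "r x p = l p x"
proof -
  have left: "l p (l q x) = l (p * q) x" for p q
    using x by (simp add: mem_assoc_nucleus_iff)
  have right: "r (r x p) q = r x (p * q)" for p q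
    using assoc_left_right[of p q x] by (simp add: left)
  have mid: "r (l q x) p = l q (r x p)" for p q
    using right_left[of q x p] by (simp add: left)
  have assoc: "l ((p * q) * w - p * (q * w)) x = r x ((p * q) * w - p * (q * w))" for p q w
  proof -
    have "l ((p * q) * w - p * (q * w)) x = l (p * q) (l w x) - l p (l q (l w x))"
      by (simp add: left left_linear)
    also have "\<dots> = r (r (l w x) p) q - r (l w x) (p * q)"
      by (rule assoc_left_right)
    \<comment> \<open>For nuclear \<open>x\<close>, [w x, p, q] = [w, x p, q]; its cyclic shift
      [x p, q, w] has \<open>x\<close> leftmost.\<close>
    also have "\<dots> = r (l w (r x p)) q - l w (r (r x p) q)"
      by (simp add: mid right)
    also have "\<dots> = r (r (r x p) q) w - r (r x p) (q * w)"
      by (rule assoc_right_middle[symmetric])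
    also have "\<dots> = r x ((p * q) * w - p * (q * w))"
      by (simp add: right right_linear)
    finally show ?thesis .
  qed
  \<comment> \<open>The triples below do not lie in one quaternion subalgebra; the associator of
    each is twice a unit.\<close>
  have unit: "r x s = l s x" if "(p * q) * w - p * (q * w) = 2 *\<^sub>R s" for p q w s
    using assoc[of p q w] unfolding that by (simp add: left_linear right_linear)
  show ?thesis
  proof (induction p rule: octo_induct)
    case e1
    show ?case by (rule unit[of e4 e2 e7]) (simp add: unit_mult octo_mult_linear scaleR_2)
  next
    case e2
    show ?case by (rule unit[of e1 e4 e7]) (simp add: unit_mult octo_mult_linear scaleR_2)
  next
    case e3
    show ?case by (rule unit[of e4 e1 e6]) (simp add: unit_mult octo_mult_linear scaleR_2)
  next
    case e4
    show ?case by (rule unit[of e2 e1 e7]) (simp add: unit_mult octo_mult_linear scaleR_2)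
  next
    case e5
    show ?case by (rule unit[of e1 e2 e6]) (simp add: unit_mult octo_mult_linear scaleR_2)
  next
    case e6
    show ?case by (rule unit[of e2 e1 e5]) (simp add: unit_mult octo_mult_linear scaleR_2)
  next
    case e7
    show ?case by (rule unit[of e1 e2 e4]) (simp add: unit_mult octo_mult_linear scaleR_2)
  qed (simp_all add: left_linear right_linear one_left right_one)
qed

lemma octo_sums_nucleus: "octo_sums l (assoc_nucleus l) = UNIV"
  by (rule octo_sums_eq_UNIV) (rule clifford_volume_eq)

text \<open>On \<open>m = l p x\<close> with \<open>x\<close> nuclear, \<open>r x q = l q x\<close>
  turns \<open>right_left\<close> into (p x) q = (p q) x, so the right action is forced.\<close>

lemma right_eq: "r m q = right_mult m q"
proof -
  have "m \<in> octo_sums l (assoc_nucleus l)"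
    by (simp add: octo_sums_nucleus)
  then show ?thesis
  proof (induction rule: octo_sums_induct)
    case (base p x)
    then have "l p (l q x) = l (p * q) x" for p q
      by (simp add: mem_assoc_nucleus_iff)
    then show ?case
      using base right_left[of p x q] by (simp add: right_mult_nucleus nucleus_commute)
  qed (simp_all add: right_linear bilinear_ladd[OF bilinear_right_mult] bilinear_lzero[OF bilinear_right_mult])
qed

end

theorem theorem1p1:
  fixes l :: "octo \<Rightarrow> 'm::real_vector \<Rightarrow> 'm"
  assumes "octo_left_module l"
  shows "((\<exists>r. octo_bimodule l r) \<longleftrightarrow> (UNIV :: 'm set) = octo_sums l (assoc_nucleus l))
    \<and> ((\<exists>r. octo_bimodule l r) \<longrightarrow> (\<exists>!r. octo_bimodule l r))"
proof -
  interpret octo_left_module l by fact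
  have "octo_sums l (assoc_nucleus l) = UNIV" if "octo_bimodule l r" for r
    using octo_bimodule.octo_sums_nucleus[OF that] .
  moreover have "r = right_mult" if "octo_bimodule l r" for r
    using octo_bimodule.right_eq[OF that] by (intro ext)
  ultimately show ?thesis
    using octo_bimodule_right_mult by metis
qed

end
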